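(* Let $n$ be a positive integer and let $p,q\in\{2,\ldots,n\}$. Then $\Sigma_n^p\subseteq\Sigma_n^q$ if and only if $p\leq q$ and at least one of the following holds: $p \equiv 2 \pmod 4$, or $q \equiv 1 \pmod 4$, or $p \equiv q \pmod 4$.
   Context: $[n]=\{0,1,\dots,n-1\}$ with its usual order. An inversion of a one-to-one partial mapping $\alpha$ on $[n]$ is a pair $a,b$ in its domain with $a<b$ and $\alpha(a)>\alpha(b)$; $\alpha$ is even if its number of inversions is even. A restriction of width $t$ of a mapping on $[n]$ is its restriction to a $t$-element subset of $[n]$. For $1\le t\le n$, $\Sigma_n^t$ is the monoid of all (full) mappings $[n]\to[n]$ all of whose injective restrictions of width $t$ are even. *)

theory Defs
  imports "HOL-Library.FuncSet" "HOL-Number_Theory.Cong"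
begin

text \<open>A partial mapping on \<open>{..<n}\<close> is given by its domain \<open>A\<close> together with a function \<open>f\<close>
  of which only the values on \<open>A\<close> matter. In particular, the restriction of \<open>f\<close> to a subset \<open>T\<close>
  is the pair \<open>T\<close>, \<open>f\<close>.\<close>

definition inversions :: "nat set \<Rightarrow> (nat \<Rightarrow> nat) \<Rightarrow> (nat \<times> nat) set" where
  "inversions A f = {(a, b). a \<in> A \<and> b \<in> A \<and> a < b \<and> f a > f b}"

definition even_map_on :: "nat set \<Rightarrow> (nat \<Rightarrow> nat) \<Rightarrow> bool" where
  "even_map_on A f \<longleftrightarrow> even (card (inversions A f))"

text \<open>The carrier of the monoid. The full mappings are extensional, so that distinct functions
  represent distinct mappings.\<close>

definition Sigma_monoid :: "nat \<Rightarrow> nat \<Rightarrow> (nat \<Rightarrow> nat) set" where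
  "Sigma_monoid n t =
    {f \<in> {..<n} \<rightarrow>\<^sub>E {..<n}.
      \<forall>T. T \<subseteq> {..<n} \<and> card T = t \<and> inj_on f T \<longrightarrow> even_map_on T f}"

end

theory Submission
  imports Defs
begin

text \<open>Fix a map that is injective on a set \<open>Q\<close> of \<open>q\<close> points, and view its inversions as the edges
  of a graph on \<open>Q\<close>. Whether all \<open>p\<close>-point induced subgraphs having evenly many edges forces the
  whole graph to have evenly many edges is a question of linear algebra over the field with two
  elements: is the complete graph on \<open>Q\<close> a sum of complete graphs on \<open>p\<close>-subsets of \<open>Q\<close>?

  Sums of the following shape suffice for the positive answers. Choose \<open>M \<subseteq> Q\<close> and add up the
  complete graphs on \<open>Q - D\<close>, for all \<open>D \<subseteq> M\<close> with \<open>d = q - p\<close> elements. A pair \<open>a, b\<close> is counted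
  \<open>card (M - {a, b}) choose d\<close> times, so the sum is the complete graph on \<open>Q\<close> as soon as all these
  binomial coefficients are odd. With \<open>M = Q\<close> this gives the steps \<open>p \<rightarrow> p + 1\<close> for even \<open>p\<close> and
  \<open>p \<rightarrow> p + 2\<close> for \<open>p\<close> congruent to 2 or 3 modulo 4. With a set \<open>M\<close> of six points it gives
  \<open>p \<rightarrow> p + 4\<close> for every \<open>p \<ge> 2\<close>, because \<open>6\<close>, \<open>5\<close> and \<open>4\<close> choose \<open>4\<close> are all odd.
  Composing these steps yields every inclusion that the criterion claims
  (\<open>Sigma_monoid_add_mult_4\<close>, \<open>Sigma_monoid_mono\<close>).

  Conversely, an odd permutation of \<open>{..<q}\<close> whose width-\<open>p\<close> restrictions are all even extends to a
  map on \<open>{..<n}\<close> that is constant from \<open>q - 1\<close> on and separates the two monoids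
  (\<open>not_Sigma_monoid_subsetI\<close>). Three permutations suffice. A transposition settles \<open>p > q\<close>, where
  there are no width-\<open>p\<close> restrictions. Rotation by one step, which carries one point past all the
  others, settles odd \<open>p\<close> and even \<open>q\<close>. The reversal, whose restriction to \<open>t\<close> points has
  \<open>t choose 2\<close> inversions, settles the remaining residues.\<close>

section \<open>Counting inversions\<close>

lemma finite_inversions [simp]: "finite A \<Longrightarrow> finite (inversions A f)"
  by (rule finite_subset[of _ "A \<times> A"]) (auto simp: inversions_def)

lemma mod_4_cases: "t mod 4 \<in> {0, 1, 2, 3}" for t :: nat
  by auto

lemma even_iff_mod_4: "even t \<longleftrightarrow> t mod 4 \<in> {0, 2}" for t :: nat
  by (simp only: insert_iff empty_iff) presburger

lemma odd_choose_2_iff: "odd (t choose 2) \<longleftrightarrow> t mod 4 \<in> {2, 3}"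
proof (induction t)
  case (Suc t)
  have "Suc t choose 2 = t + (t choose 2)"
    by (simp add: numeral_2_eq_2)
  then have "odd (Suc t choose 2) \<longleftrightarrow> odd t \<noteq> odd (t choose 2)"
    by simp
  also have "\<dots> \<longleftrightarrow> Suc t mod 4 \<in> {2, 3}"
    unfolding Suc.IH by (simp only: insert_iff empty_iff) presburger
  finally show ?case .
qed (simp add: numeral_2_eq_2)

text \<open>Double counting: both sides count the pairs consisting of a set \<open>D\<close> and an inversion of \<open>f\<close>
  on \<open>Q\<close> that avoids \<open>D\<close>.\<close>

lemma sum_card_inversions_Diff:
  assumes Q: "finite Q" and "M \<subseteq> Q"
  shows "(\<Sum>D | D \<subseteq> M \<and> card D = d. card (inversions (Q - D) f)) =
    (\<Sum>(a, b)\<in>inversions Q f. card (M - {a, b}) choose d)"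
proof -
  have M: "finite M"
    using assms finite_subset by blast
  let ?\<D> = "{D. D \<subseteq> M \<and> card D = d}"
  have fin: "finite ?\<D>"
    using M by simp
  have "(\<Sum>D\<in>?\<D>. card (inversions (Q - D) f)) =
      (\<Sum>D\<in>?\<D>. \<Sum>x\<in>inversions Q f. of_bool (fst x \<notin> D \<and> snd x \<notin> D))"
  proof (rule sum.cong[OF refl])
    fix D
    have "inversions (Q - D) f = inversions Q f \<inter> {x. fst x \<notin> D \<and> snd x \<notin> D}"
      by (auto simp: inversions_def)
    then show "card (inversions (Q - D) f) =
        (\<Sum>x\<in>inversions Q f. of_bool (fst x \<notin> D \<and> snd x \<notin> D))"
      using Q by simp
  qed
  also have "\<dots> = (\<Sum>x\<in>inversions Q f. \<Sum>D\<in>?\<D>. of_bool (fst x \<notin> D \<and> snd x \<notin> D))"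
    by (rule sum.swap)
  also have "\<dots> = (\<Sum>(a, b)\<in>inversions Q f. card (M - {a, b}) choose d)"
  proof (rule sum.cong[OF refl], clarify)
    fix a b
    have "(\<Sum>D\<in>?\<D>. of_bool (a \<notin> D \<and> b \<notin> D)) = card (?\<D> \<inter> {D. a \<notin> D \<and> b \<notin> D})"
      using fin by simp
    also have "?\<D> \<inter> {D. a \<notin> D \<and> b \<notin> D} = {D. D \<subseteq> M - {a, b} \<and> card D = d}"
      by auto
    also have "card \<dots> = card (M - {a, b}) choose d"
      using M by (intro n_subsets) simp
    finally show "(\<Sum>D\<in>?\<D>. of_bool (fst (a, b) \<notin> D \<and> snd (a, b) \<notin> D)) =
        card (M - {a, b}) choose d"
      by simp
  qed
  finally show ?thesis .
qed

section \<open>Inclusions\<close>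

text \<open>Modulo 2, the oddness hypothesis turns the right-hand side of
  \<open>sum_card_inversions_Diff\<close> into the number of inversions on \<open>Q\<close>, while every summand on the
  left-hand side comes from a restriction that is already known to be even.\<close>

lemma even_map_on_if_even_map_on_Diff:
  assumes Q: "finite Q" and M: "M \<subseteq> Q"
    and odd: "\<And>a b. a \<in> Q \<Longrightarrow> b \<in> Q \<Longrightarrow> a < b \<Longrightarrow> odd (card (M - {a, b}) choose d)"
    and even: "\<And>D. D \<subseteq> M \<Longrightarrow> card D = d \<Longrightarrow> even_map_on (Q - D) f"
  shows "even_map_on Q f"
proof -
  have "even (\<Sum>D | D \<subseteq> M \<and> card D = d. card (inversions (Q - D) f))"
    using even by (intro dvd_sum) (auto simp: even_map_on_def)
  then have "even (\<Sum>(a, b)\<in>inversions Q f. card (M - {a, b}) choose d)"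
    using sum_card_inversions_Diff[OF Q M] by simp
  moreover have "{x \<in> inversions Q f. odd (case x of (a, b) \<Rightarrow> card (M - {a, b}) choose d)} =
      inversions Q f"
    using odd by (auto simp: inversions_def)
  ultimately show ?thesis
    using Q by (simp add: even_sum_iff even_map_on_def)
qed

lemma Sigma_monoid_subset_add:
  assumes "\<And>Q. Q \<subseteq> {..<n} \<Longrightarrow> card Q = p + d \<Longrightarrow>
    \<exists>M\<subseteq>Q. \<forall>a\<in>Q. \<forall>b\<in>Q. a < b \<longrightarrow> odd (card (M - {a, b}) choose d)"
  shows "Sigma_monoid n p \<subseteq> Sigma_monoid n (p + d)"
proof
  fix f assume f: "f \<in> Sigma_monoid n p"
  have "even_map_on Q f" if Q: "Q \<subseteq> {..<n}" "card Q = p + d" "inj_on f Q" for Q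
  proof -
    have finQ: "finite Q"
      using Q(1) finite_subset by blast
    obtain M where M: "M \<subseteq> Q"
      and odd: "\<And>a b. a \<in> Q \<Longrightarrow> b \<in> Q \<Longrightarrow> a < b \<Longrightarrow> odd (card (M - {a, b}) choose d)"
      using assms[OF Q(1,2)] by blast
    show ?thesis
    proof (rule even_map_on_if_even_map_on_Diff[OF finQ M odd])
      fix D assume D: "D \<subseteq> M" "card D = d"
      then have "D \<subseteq> Q"
        using M by blast
      then have "card (Q - D) = p"
        using D Q(2) finQ by (simp add: card_Diff_subset finite_subset)
      moreover have "Q - D \<subseteq> {..<n}" "inj_on f (Q - D)"
        using Q by (auto intro: inj_on_diff)
      ultimately show "even_map_on (Q - D) f"
        using f by (simp add: Sigma_monoid_def)
    qed
  qed
  then show "f \<in> Sigma_monoid n (p + d)"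
    using f by (simp add: Sigma_monoid_def)
qed

lemma Sigma_monoid_subset_if_odd_choose:
  assumes "odd (p + d - 2 choose d)"
  shows "Sigma_monoid n p \<subseteq> Sigma_monoid n (p + d)"
proof (rule Sigma_monoid_subset_add)
  fix Q :: "nat set" assume Q: "card Q = p + d"
  have "odd (card (Q - {a, b}) choose d)" if "a \<in> Q" "b \<in> Q" "a < b" for a b
    using that Q assms by (simp add: card_Diff_subset numeral_2_eq_2)
  then show "\<exists>M\<subseteq>Q. \<forall>a\<in>Q. \<forall>b\<in>Q. a < b \<longrightarrow> odd (card (M - {a, b}) choose d)"
    by blast
qed

lemma Sigma_monoid_add_1:
  assumes "even p" "p > 0"
  shows "Sigma_monoid n p \<subseteq> Sigma_monoid n (p + 1)"
  using assms by (intro Sigma_monoid_subset_if_odd_choose) auto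

lemma Sigma_monoid_add_2:
  assumes "p mod 4 \<in> {2, 3}"
  shows "Sigma_monoid n p \<subseteq> Sigma_monoid n (p + 2)"
  using assms by (intro Sigma_monoid_subset_if_odd_choose) (simp add: odd_choose_2_iff)

text \<open>Taking \<open>M = Q\<close> would require \<open>p + 2 choose 4\<close> to be odd, which fails for instance for
  \<open>p = 6\<close>. A set \<open>M\<close> of six points works for every \<open>p\<close>: the two ends of a pair remove zero, one or
  two of its points, and \<open>6\<close>, \<open>5\<close> and \<open>4\<close> choose \<open>4\<close> are \<open>15\<close>, \<open>5\<close> and \<open>1\<close>.\<close>

lemma Sigma_monoid_add_4:
  assumes "p \<ge> 2"
  shows "Sigma_monoid n p \<subseteq> Sigma_monoid n (p + 4)"
proof (rule Sigma_monoid_subset_add)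
  fix Q :: "nat set" assume "card Q = p + 4"
  then obtain M where M: "M \<subseteq> Q" "card M = 6" "finite M"
    using assms obtain_subset_with_card_n[of 6 Q] by auto
  have "odd (card (M - {a, b}) choose 4)" for a b
  proof -
    have "card (M \<inter> {a, b}) \<le> card {a, b}"
      by (intro card_mono) auto
    also have "\<dots> \<le> 2"
      by (simp add: card_insert_if)
    finally have "card (M - {a, b}) \<in> {4, 5, 6}"
      using M by (auto simp: card_Diff_subset_Int)
    moreover have "odd ((4::nat) choose 4)" "odd ((5::nat) choose 4)" "odd ((6::nat) choose 4)"
      by code_simp+
    ultimately show ?thesis
      by auto
  qed
  then show "\<exists>M\<subseteq>Q. \<forall>a\<in>Q. \<forall>b\<in>Q. a < b \<longrightarrow> odd (card (M - {a, b}) choose 4)"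
    using M by blast
qed

lemma Sigma_monoid_add_mult_4:
  assumes "p \<ge> 2"
  shows "Sigma_monoid n p \<subseteq> Sigma_monoid n (p + 4 * k)"
proof (induction k)
  case (Suc k)
  also have "Sigma_monoid n (p + 4 * k) \<subseteq> Sigma_monoid n (p + 4 * k + 4)"
    using assms by (intro Sigma_monoid_add_4) simp
  finally show ?case
    by (simp add: algebra_simps)
qed simp

lemma Sigma_monoid_mono:
  assumes "2 \<le> p" "p \<le> q" and "[p = 2] (mod 4) \<or> [q = 1] (mod 4) \<or> [p = q] (mod 4)"
  shows "Sigma_monoid n p \<subseteq> Sigma_monoid n q"
proof -
  \<comment> \<open>At most two short steps, two only when passing from residue 2 to residue 1, reach the
    residue of \<open>q\<close>; steps of length 4 then do the rest.\<close>
  define r where "r = (q - p) mod 4"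
  have q: "q = p + r + 4 * ((q - p) div 4)"
    using assms(2) by (simp add: r_def)
  have "Sigma_monoid n p \<subseteq> Sigma_monoid n (p + r)"
  proof -
    have "q mod 4 = (p mod 4 + r) mod 4"
      using assms(2) unfolding r_def by (metis le_add_diff_inverse mod_add_eq mod_mod_trivial)
    moreover have "p mod 4 = 2 \<or> q mod 4 = 1 \<or> p mod 4 = q mod 4"
      using assms(3) by (simp add: cong_def)
    moreover have "p mod 4 \<in> {0, 1, 2, 3}" "r \<in> {0, 1, 2, 3}"
      unfolding r_def by (rule mod_4_cases)+
    ultimately have "r = 0 \<or> r = 1 \<and> even p \<or> r = 2 \<and> (p mod 4 = 2 \<or> p mod 4 = 3)
        \<or> r = 3 \<and> p mod 4 = 2"
      by (auto simp: even_iff_mod_4)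
    then consider "r = 0" | "r = 1" "even p" | "r = 2" "p mod 4 \<in> {2, 3}" | "r = 3" "p mod 4 = 2"
      by auto
    then show ?thesis
    proof cases
      case 2
      then show ?thesis
        using Sigma_monoid_add_1 assms(1) by simp
    next
      case 3
      then show ?thesis
        using Sigma_monoid_add_2 by simp
    next
      case 4
      have "Sigma_monoid n p \<subseteq> Sigma_monoid n (p + 2)"
        using 4 by (intro Sigma_monoid_add_2) simp
      also have "\<dots> \<subseteq> Sigma_monoid n (p + 2 + 1)"
        using 4 by (intro Sigma_monoid_add_1) presburger+
      finally show ?thesis
        using 4 by (simp add: numeral_3_eq_3)
    qed simp
  qed
  also have "\<dots> \<subseteq> Sigma_monoid n q"
    using assms(1) Sigma_monoid_add_mult_4[of "p + r" n "(q - p) div 4"] q by simp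
  finally show ?thesis .
qed

section \<open>Separating maps\<close>

lemma even_map_on_comp_strict_mono_on:
  assumes "strict_mono_on T h"
  shows "even_map_on T (g \<circ> h) \<longleftrightarrow> even_map_on (h ` T) g"
proof -
  have inj: "inj_on h T"
    using assms by (rule strict_mono_on_imp_inj_on)
  have less: "h a < h b \<longleftrightarrow> a < b" if "a \<in> T" "b \<in> T" for a b
    using that assms by (simp add: strict_mono_on_less)
  have "map_prod h h ` inversions T (g \<circ> h) = inversions (h ` T) g"
  proof (intro equalityI subsetI)
    fix y assume "y \<in> inversions (h ` T) g"
    then obtain a b where ab: "a \<in> T" "b \<in> T" "y = map_prod h h (a, b)"
      and "h a < h b" "g (h b) < g (h a)"
      by (auto simp: inversions_def)
    then have "(a, b) \<in> inversions T (g \<circ> h)"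
      using less by (simp add: inversions_def)
    then show "y \<in> map_prod h h ` inversions T (g \<circ> h)"
      using ab(3) by blast
  qed (auto simp: inversions_def less)
  moreover have "inj_on (map_prod h h) (inversions T (g \<circ> h))"
    by (rule inj_on_subset[OF map_prod_inj_on[OF inj inj]]) (auto simp: inversions_def)
  ultimately have "card (inversions T (g \<circ> h)) = card (inversions (h ` T) g)"
    by (metis card_image)
  then show ?thesis
    by (simp add: even_map_on_def)
qed

text \<open>The permutation is extended by collapsing everything from \<open>q - 1\<close> on to that point. The
  collapse is monotone, so it is strictly monotone wherever the extension is injective, and the
  extension then has the inversions of a restriction of the permutation.\<close>

lemma not_Sigma_monoid_subsetI:
  assumes q: "0 < q" "q \<le> n"
    and g: "bij_betw g {..<q} {..<q}"
    and even: "\<And>T. T \<subseteq> {..<q} \<Longrightarrow> card T = p \<Longrightarrow> even_map_on T g"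
    and odd: "\<not> even_map_on {..<q} g"
  shows "\<not> Sigma_monoid n p \<subseteq> Sigma_monoid n q"
proof -
  define h where "h i = min i (q - 1)" for i
  define f where "f = restrict (g \<circ> h) {..<n}"
  have h_less: "h i < q" for i
    using q by (auto simp: h_def)
  have inv_f: "inversions T f = inversions T (g \<circ> h)" if "T \<subseteq> {..<n}" for T
    using that by (auto simp: inversions_def f_def subset_iff)
  have f_even: "even_map_on T f \<longleftrightarrow> even_map_on (h ` T) g"
    if "T \<subseteq> {..<n}" "inj_on h T" for T
  proof -
    have "mono_on T h"
      by (auto simp: h_def mono_on_def)
    then have "strict_mono_on T h"
      using that(2) by (simp add: strict_mono_on_def mono_on_def inj_on_def order_less_le) blast
    then show ?thesis
      using even_map_on_comp_strict_mono_on inv_f[OF that(1)] by (simp add: even_map_on_def)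
  qed
  have "f \<in> {..<n} \<rightarrow>\<^sub>E {..<n}"
  proof -
    have "g (h i) < n" for i
      using h_less[of i] bij_betwE[OF g] q(2) by (meson lessThan_iff order_less_le_trans)
    then show ?thesis
      by (simp add: f_def)
  qed
  moreover have "even_map_on T f" if T: "T \<subseteq> {..<n}" "card T = p" "inj_on f T" for T
  proof -
    have "inj_on (g \<circ> h) T"
      using T(1,3) by (auto simp: inj_on_def f_def subset_iff)
    then have inj: "inj_on h T"
      by (rule inj_on_imageI2)
    have "even_map_on (h ` T) g"
      using h_less T(2) inj by (intro even) (auto simp: card_image)
    then show ?thesis
      using f_even[OF T(1) inj] by simp
  qed
  ultimately have "f \<in> Sigma_monoid n p"
    by (simp add: Sigma_monoid_def)
  moreover have "f \<notin> Sigma_monoid n q"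
  proof -
    have sub: "{..<q} \<subseteq> {..<n}"
      using q by auto
    have h_id: "h i = i" if "i < q" for i
      using that by (simp add: h_def)
    have "inj_on f {..<q} \<longleftrightarrow> inj_on g {..<q}"
      using sub by (intro inj_on_cong) (auto simp: f_def h_id)
    then have "inj_on f {..<q}"
      using g by (simp add: bij_betw_def)
    moreover have "\<not> even_map_on {..<q} f"
      using f_even[OF sub] odd h_id by (simp add: inj_on_def)
    ultimately show ?thesis
      using sub by (auto simp: Sigma_monoid_def)
  qed
  ultimately show ?thesis
    by blast
qed

lemma not_Sigma_monoid_subset_if_less:
  assumes "2 \<le> q" "q \<le> n" "q < p"
  shows "\<not> Sigma_monoid n p \<subseteq> Sigma_monoid n q"
proof (rule not_Sigma_monoid_subsetI)
  define g :: "nat \<Rightarrow> nat" where "g = id(0 := 1, 1 := 0)"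
  show "bij_betw g {..<q} {..<q}"
    using assms by (intro bij_betw_byWitness[of _ g]) (auto simp: g_def)
  show "even_map_on T g" if "T \<subseteq> {..<q}" "card T = p" for T
    using that assms card_mono[of "{..<q}" T] by simp
  have "inversions {..<q} g = {(0, 1)}"
    using assms by (auto simp: inversions_def g_def split: if_splits)
  then show "\<not> even_map_on {..<q} g"
    by (simp add: even_map_on_def)
qed (use assms in auto)

lemma not_Sigma_monoid_subset_if_odd_even:
  assumes "0 < q" "q \<le> n" "odd p" "even q"
  shows "\<not> Sigma_monoid n p \<subseteq> Sigma_monoid n q"
proof (rule not_Sigma_monoid_subsetI)
  define g where "g i = (if i = 0 then q - 1 else i - 1)" for i
  have inv: "inversions T g = (if 0 \<in> T then {0} \<times> (T - {0}) else {})" if "T \<subseteq> {..<q}" for T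
    using that assms(1) by (force simp: inversions_def g_def split: if_splits)
  have even_iff: "even_map_on T g \<longleftrightarrow> 0 \<notin> T \<or> odd (card T)" if "T \<subseteq> {..<q}" for T
  proof -
    have "finite T"
      using that finite_subset by blast
    then have "0 \<in> T \<Longrightarrow> card T > 0"
      by (auto simp: card_gt_0_iff)
    then show ?thesis
      using inv[OF that] \<open>finite T\<close> by (auto simp: even_map_on_def card_cartesian_product)
  qed
  show "bij_betw g {..<q} {..<q}"
    using assms(1)
    by (intro bij_betw_byWitness[of _ "\<lambda>i. if i = q - 1 then 0 else i + 1"]) (auto simp: g_def)
  show "even_map_on T g" if "T \<subseteq> {..<q}" "card T = p" for T
    using that assms even_iff by simp
  show "\<not> even_map_on {..<q} g"
    using assms even_iff by simp
qed (use assms in auto)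

lemma card_inversions_strict_antimono_on:
  assumes "finite T" "\<And>a b. a \<in> T \<Longrightarrow> b \<in> T \<Longrightarrow> a < b \<Longrightarrow> f b < f a"
  shows "card (inversions T f) = card T choose 2"
  using assms
proof (induction T rule: finite_linorder_max_induct)
  case empty
  then show ?case
    by (simp add: inversions_def)
next
  case (insert b A)
  have "inversions (insert b A) f = inversions A f \<union> A \<times> {b}"
    using insert.hyps(2) insert.prems by (force simp: inversions_def)
  moreover have "inversions A f \<inter> A \<times> {b} = {}"
    using insert.hyps(2) by (auto simp: inversions_def)
  ultimately have "card (inversions (insert b A) f) = card (inversions A f) + card A"
    using insert.hyps(1) by (simp add: card_Un_disjoint card_cartesian_product)
  moreover have "b \<notin> A"
    using insert.hyps(2) by blast
  ultimately show ?case
    using insert by (simp add: numeral_2_eq_2)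
qed

lemma not_Sigma_monoid_subset_if_choose_2:
  assumes "0 < q" "q \<le> n" "even (p choose 2)" "odd (q choose 2)"
  shows "\<not> Sigma_monoid n p \<subseteq> Sigma_monoid n q"
proof (rule not_Sigma_monoid_subsetI)
  define g where "g i = q - 1 - i" for i
  have even_iff: "even_map_on T g \<longleftrightarrow> even (card T choose 2)" if "T \<subseteq> {..<q}" for T
  proof -
    have "card (inversions T g) = card T choose 2"
      using that finite_subset[OF that]
      by (intro card_inversions_strict_antimono_on) (auto simp: g_def subset_iff)
    then show ?thesis
      by (simp add: even_map_on_def)
  qed
  show "bij_betw g {..<q} {..<q}"
    using assms(1) by (intro bij_betw_byWitness[of _ g]) (auto simp: g_def)
  show "even_map_on T g" if "T \<subseteq> {..<q}" "card T = p" for T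
    using that assms even_iff by simp
  show "\<not> even_map_on {..<q} g"
    using assms even_iff by simp
qed (use assms in auto)

section \<open>The criterion\<close>

theorem theorem22:
  fixes n p q :: nat
  assumes "n > 0" and "p \<in> {2..n}" and "q \<in> {2..n}"
  shows "Sigma_monoid n p \<subseteq> Sigma_monoid n q \<longleftrightarrow>
    p \<le> q \<and> ([p = 2] (mod 4) \<or> [q = 1] (mod 4) \<or> [p = q] (mod 4))"
proof
  assume "p \<le> q \<and> ([p = 2] (mod 4) \<or> [q = 1] (mod 4) \<or> [p = q] (mod 4))"
  then show "Sigma_monoid n p \<subseteq> Sigma_monoid n q"
    using assms(2) by (intro Sigma_monoid_mono) auto
next
  assume sub: "Sigma_monoid n p \<subseteq> Sigma_monoid n q"
  have q: "2 \<le> q" "q \<le> n"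
    using assms(3) by auto
  have "p \<le> q"
    using not_Sigma_monoid_subset_if_less[OF q] sub by (meson not_le)
  moreover have "even p \<or> odd q"
    using not_Sigma_monoid_subset_if_odd_even[of q n p] sub q by auto
  moreover have "p mod 4 \<in> {2, 3} \<or> q mod 4 \<notin> {2, 3}"
    using not_Sigma_monoid_subset_if_choose_2[of q n p] sub q
    by (simp only: odd_choose_2_iff[symmetric]) auto
  ultimately show "p \<le> q \<and> ([p = 2] (mod 4) \<or> [q = 1] (mod 4) \<or> [p = q] (mod 4))"
    using mod_4_cases[of p] mod_4_cases[of q]
    by (auto simp: cong_def even_iff_mod_4[of p] even_iff_mod_4[of q])
qed

end
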